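(* Let $\chi_{\boldsymbol\ell}$ and $\mathbb W_{\boldsymbol\ell}\in\mathbb R^4$ be the nodal values on an element $K$ of the densitization factor and the evolved state, and let $\mu_{\boldsymbol\ell}>0$ be the nodal mass weights. Assume $\chi_{\boldsymbol\ell}>0$ at every node, $\overline\chi_K>0$, and $\overline{\mathbb W}_K\in\mathcal G$. Then the explicit three-stage scaling $\mathbb W\mapsto\mathbb W^{(1)}\mapsto\mathbb W^{(2)}\mapsto\mathbb W^{L}$ (density stage with factor $\theta_D$, cone stage with factor $\theta_q$, margin stage with factor $\theta_\delta$) preserves the conservative cell average, i.e. $\overline{\mathbb W^{L}}_K=\overline{\mathbb W}_K$ and likewise after each stage, and places every nodal local state $\widehat U^{L}_{\boldsymbol\ell}=\mathbb W^{L}_{\boldsymbol\ell}/\chi_{\boldsymbol\ell}$ in $\mathcal G_K^{\rm cert}$. If the unlimited polynomial already satisfies all certification conditions (that is, $\mathbb W_{\boldsymbol\ell}/\chi_{\boldsymbol\ell}\in\mathcal G_K^{\rm cert}$ at every node), then $\theta_D=\theta_q=\theta_\delta=1$.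
   Context: Cone. For $Z=(D,m,E)^T$, $D,E\in\mathbb R$, $m\in\mathbb R^2$: $R(Z)=\sqrt{D^2+|m|^2}$, $q(Z)=E-R(Z)$, $\mathcal G=\{Z:D>0,\ q(Z)>0\}$. For $Z\in\mathcal G$, $\nu(Z)=\frac{E-R(Z)}{E+R(Z)}$; for $0\le\delta<1$, $g_\delta(Z)=(1-\delta)E-(1+\delta)R(Z)$. A subscript $D$, $m_a$ or $E$ on a vector denotes the corresponding component. Averages and anchor. For a nodal field $Z$, $\overline Z_K=\sum_{\boldsymbol\ell}\mu_{\boldsymbol\ell}Z_{\boldsymbol\ell}/\sum_{\boldsymbol\ell}\mu_{\boldsymbol\ell}$. (In the application $\chi=wj_2$, where $w$ is the reduction weight and $j_2$ the active volume density.) Set $\widehat U_{A,K}=\overline{\mathbb W}_K/\overline\chi_K$, $\mathbb W^{\rm ref}_{\boldsymbol\ell}=\chi_{\boldsymbol\ell}\widehat U_{A,K}$, $\widehat U^{(0)}_{\boldsymbol\ell}=\mathbb W_{\boldsymbol\ell}/\chi_{\boldsymbol\ell}$. Floors and certification set. Fix $\varepsilon_D>0$, $\varepsilon_q>0$, $0\le\eta_{\rm PCP}<1$. Put $\varepsilon_{D,K}^{\rm eff}=\min\{\varepsilon_D,(\widehat U_{A,K})_D\}$, $\varepsilon_{q,K}^{\rm eff}=\min\{\varepsilon_q,q(\widehat U_{A,K})\}$, $\delta_K=\eta_{\rm PCP}\,\nu(\widehat U_{A,K})$, and $$\mathcal G_K^{\rm cert}=\{Z:\ D\ge\varepsilon_{D,K}^{\rm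 eff},\ q(Z)\ge\varepsilon_{q,K}^{\rm eff},\ g_{\delta_K}(Z)\ge0\}.$$ Density stage. $D_{\min}^{(0)}=\min_{\boldsymbol\ell}(\widehat U^{(0)}_{\boldsymbol\ell})_D$; $\theta_D=1$ if $D_{\min}^{(0)}\ge\varepsilon_{D,K}^{\rm eff}$, otherwise $\theta_D=\frac{(\widehat U_{A,K})_D-\varepsilon_{D,K}^{\rm eff}}{(\widehat U_{A,K})_D-D_{\min}^{(0)}}$. Then $(\mathbb W^{(1)}_{\boldsymbol\ell})_D=(\mathbb W^{\rm ref}_{\boldsymbol\ell})_D+\theta_D[(\mathbb W_{\boldsymbol\ell})_D-(\mathbb W^{\rm ref}_{\boldsymbol\ell})_D]$, while the $m_1,m_2,E$ components of $\mathbb W^{(1)}_{\boldsymbol\ell}$ equal those of $\mathbb W_{\boldsymbol\ell}$; $\widehat U^{(1)}_{\boldsymbol\ell}=\mathbb W^{(1)}_{\boldsymbol\ell}/\chi_{\boldsymbol\ell}$. Cone stage. $q_{\min}^{(1)}=\min_{\boldsymbol\ell}q(\widehat U^{(1)}_{\boldsymbol\ell})$; $\theta_q=1$ if $q_{\min}^{(1)}\ge\varepsilon_{q,K}^{\rm eff}$, otherwise $\theta_q=\frac{q(\widehat U_{A,K})-\varepsilon_{q,K}^{\rm eff}}{q(\widehat U_{A,K})-q_{\min}^{(1)}}$. Then $\mathbb W^{(2)}_{\boldsymbol\ell}=\mathbb W^{\rm ref}_{\boldsymbol\ell}+\theta_q(\mathbb W^{(1)}_{\boldsymbol\ell}-\mathbb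 W^{\rm ref}_{\boldsymbol\ell})$, $\widehat U^{(2)}_{\boldsymbol\ell}=\mathbb W^{(2)}_{\boldsymbol\ell}/\chi_{\boldsymbol\ell}$. Margin stage. $g_{A,K}=g_{\delta_K}(\widehat U_{A,K})=(1-\eta_{\rm PCP})q(\widehat U_{A,K})>0$, $g_{\min}^{(2)}=\min_{\boldsymbol\ell}g_{\delta_K}(\widehat U^{(2)}_{\boldsymbol\ell})$; $\theta_\delta=1$ if $g_{\min}^{(2)}\ge0$, otherwise $\theta_\delta=\frac{g_{A,K}}{g_{A,K}-g_{\min}^{(2)}}$. Then $\mathbb W^{L}_{\boldsymbol\ell}=\mathbb W^{\rm ref}_{\boldsymbol\ell}+\theta_\delta(\mathbb W^{(2)}_{\boldsymbol\ell}-\mathbb W^{\rm ref}_{\boldsymbol\ell})$. *)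

theory Defs
  imports "HOL-Analysis.Analysis"
begin

text \<open>
  A state \<open>Z = (D, m, E)\<close> in \<open>\<real>\<^sup>4\<close> is kept as a triple with \<open>m\<close> in \<open>\<real>\<^sup>2\<close>;
  the vector space operations are those of the product type, i.e. componentwise.
\<close>

type_synonym state = "real \<times> (real ^ 2) \<times> real"

definition dens :: "state \<Rightarrow> real" where
  "dens Z = fst Z"

definition mom :: "state \<Rightarrow> real ^ 2" where
  "mom Z = fst (snd Z)"

definition ener :: "state \<Rightarrow> real" where
  "ener Z = snd (snd Z)"

definition Rcone :: "state \<Rightarrow> real" where
  "Rcone Z = sqrt ((dens Z)\<^sup>2 + (norm (mom Z))\<^sup>2)"

definition qcone :: "state \<Rightarrow> real" where
  "qcone Z = ener Z - Rcone Z"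

definition Gcone :: "state set" where
  "Gcone = {Z. dens Z > 0 \<and> qcone Z > 0}"

definition nu_margin :: "state \<Rightarrow> real" where
  "nu_margin Z = (ener Z - Rcone Z) / (ener Z + Rcone Z)"

definition g_margin :: "real \<Rightarrow> state \<Rightarrow> real" where
  "g_margin \<delta> Z = (1 - \<delta>) * ener Z - (1 + \<delta>) * Rcone Z"

text \<open>
  Nodal fields on an element are functions on a finite node set \<open>L\<close> with mass weights \<open>\<mu>\<close>.
  The average is used both for scalar fields (\<open>chi\<close>) and for state-valued ones.
\<close>

definition cell_avg :: "'l set \<Rightarrow> ('l \<Rightarrow> real) \<Rightarrow> ('l \<Rightarrow> 'a) \<Rightarrow> 'a::real_vector" where
  "cell_avg L \<mu> Z = (\<Sum>l\<in>L. \<mu> l *\<^sub>R Z l) /\<^sub>R (\<Sum>l\<in>L. \<mu> l)"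

definition anchor :: "'l set \<Rightarrow> ('l \<Rightarrow> real) \<Rightarrow> ('l \<Rightarrow> real) \<Rightarrow> ('l \<Rightarrow> state) \<Rightarrow> state" where
  "anchor L \<mu> chi W = cell_avg L \<mu> W /\<^sub>R cell_avg L \<mu> chi"

definition W_ref :: "'l set \<Rightarrow> ('l \<Rightarrow> real) \<Rightarrow> ('l \<Rightarrow> real) \<Rightarrow> ('l \<Rightarrow> state) \<Rightarrow> 'l \<Rightarrow> state" where
  "W_ref L \<mu> chi W l = chi l *\<^sub>R anchor L \<mu> chi W"

definition local_state :: "('l \<Rightarrow> real) \<Rightarrow> ('l \<Rightarrow> state) \<Rightarrow> 'l \<Rightarrow> state" where
  "local_state chi V l = V l /\<^sub>R chi l"

text \<open>
  The floors, the margin parameter and the certification set depend on the element only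
  through its anchor state \<open>A\<close>.
\<close>

definition eps_D_eff :: "real \<Rightarrow> state \<Rightarrow> real" where
  "eps_D_eff \<epsilon>D A = min \<epsilon>D (dens A)"

definition eps_q_eff :: "real \<Rightarrow> state \<Rightarrow> real" where
  "eps_q_eff \<epsilon>q A = min \<epsilon>q (qcone A)"

definition delta_cell :: "real \<Rightarrow> state \<Rightarrow> real" where
  "delta_cell \<eta> A = \<eta> * nu_margin A"

definition G_cert :: "real \<Rightarrow> real \<Rightarrow> real \<Rightarrow> state \<Rightarrow> state set" where
  "G_cert \<epsilon>D \<epsilon>q \<eta> A =
     {Z. dens Z \<ge> eps_D_eff \<epsilon>D A \<and> qcone Z \<ge> eps_q_eff \<epsilon>q A \<and>
         g_margin (delta_cell \<eta> A) Z \<ge> 0}"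

text \<open>In every stage the anchor and reference state remain those of the unlimited field \<open>W\<close>.\<close>

definition theta_D ::
  "'l set \<Rightarrow> ('l \<Rightarrow> real) \<Rightarrow> ('l \<Rightarrow> real) \<Rightarrow> real \<Rightarrow> ('l \<Rightarrow> state) \<Rightarrow> real" where
  "theta_D L \<mu> chi \<epsilon>D W =
     (let A = anchor L \<mu> chi W;
          e = eps_D_eff \<epsilon>D A;
          Dmin = Min ((\<lambda>l. dens (local_state chi W l)) ` L)
      in if Dmin \<ge> e then 1 else (dens A - e) / (dens A - Dmin))"

definition W_stage1 ::
  "'l set \<Rightarrow> ('l \<Rightarrow> real) \<Rightarrow> ('l \<Rightarrow> real) \<Rightarrow> real \<Rightarrow> ('l \<Rightarrow> state) \<Rightarrow> 'l \<Rightarrow> state" where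
  "W_stage1 L \<mu> chi \<epsilon>D W l =
     (dens (W_ref L \<mu> chi W l)
        + theta_D L \<mu> chi \<epsilon>D W * (dens (W l) - dens (W_ref L \<mu> chi W l)),
      mom (W l), ener (W l))"

definition theta_q ::
  "'l set \<Rightarrow> ('l \<Rightarrow> real) \<Rightarrow> ('l \<Rightarrow> real) \<Rightarrow> real \<Rightarrow> real \<Rightarrow> ('l \<Rightarrow> state) \<Rightarrow> real" where
  "theta_q L \<mu> chi \<epsilon>D \<epsilon>q W =
     (let A = anchor L \<mu> chi W;
          e = eps_q_eff \<epsilon>q A;
          qmin = Min ((\<lambda>l. qcone (local_state chi (W_stage1 L \<mu> chi \<epsilon>D W) l)) ` L)
      in if qmin \<ge> e then 1 else (qcone A - e) / (qcone A - qmin))"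

definition W_stage2 ::
  "'l set \<Rightarrow> ('l \<Rightarrow> real) \<Rightarrow> ('l \<Rightarrow> real) \<Rightarrow> real \<Rightarrow> real \<Rightarrow> ('l \<Rightarrow> state) \<Rightarrow> 'l \<Rightarrow> state" where
  "W_stage2 L \<mu> chi \<epsilon>D \<epsilon>q W l =
     W_ref L \<mu> chi W l
       + theta_q L \<mu> chi \<epsilon>D \<epsilon>q W *\<^sub>R (W_stage1 L \<mu> chi \<epsilon>D W l - W_ref L \<mu> chi W l)"

definition theta_delta ::
  "'l set \<Rightarrow> ('l \<Rightarrow> real) \<Rightarrow> ('l \<Rightarrow> real) \<Rightarrow> real \<Rightarrow> real \<Rightarrow> real \<Rightarrow> ('l \<Rightarrow> state) \<Rightarrow> real" where
  "theta_delta L \<mu> chi \<epsilon>D \<epsilon>q \<eta> W =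
     (let A = anchor L \<mu> chi W;
          \<delta> = delta_cell \<eta> A;
          gA = g_margin \<delta> A;
          gmin = Min ((\<lambda>l. g_margin \<delta> (local_state chi (W_stage2 L \<mu> chi \<epsilon>D \<epsilon>q W) l)) ` L)
      in if gmin \<ge> 0 then 1 else gA / (gA - gmin))"

definition W_limited ::
  "'l set \<Rightarrow> ('l \<Rightarrow> real) \<Rightarrow> ('l \<Rightarrow> real) \<Rightarrow> real \<Rightarrow> real \<Rightarrow> real \<Rightarrow> ('l \<Rightarrow> state) \<Rightarrow> 'l \<Rightarrow> state" where
  "W_limited L \<mu> chi \<epsilon>D \<epsilon>q \<eta> W l =
     W_ref L \<mu> chi W l
       + theta_delta L \<mu> chi \<epsilon>D \<epsilon>q \<eta> W *\<^sub>R (W_stage2 L \<mu> chi \<epsilon>D \<epsilon>q W l - W_ref L \<mu> chi W l)"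

end

theory Submission
  imports Defs
begin

text \<open>
  Everything rests on two observations about the anchor state \<open>A\<close>, the quotient of the two
  cell averages.

  The reference field \<open>chi * A\<close> has by construction the same average as \<open>W\<close>.  Each stage
  changes a field with that average by a linear map applied to its deviation from the reference
  field, and that deviation has average zero.  So no stage moves the average
  (\<open>cell_avg_add_linear_deviation\<close>).

  After division by \<open>chi\<close>, a stage moves every nodal state along the segment towards \<open>A\<close>
  (in the first stage only the density moves).  The three certified quantities \<open>dens\<close>, \<open>qcone\<close>
  and \<open>g_margin\<close> are concave in the state, because \<open>Rcone\<close> is a Euclidean norm.  On the segment
  each of them therefore dominates its linear interpolant, and all three factors are given by one
  formula, the largest parameter in \<open>[0, 1]\<close> at which the interpolant between the anchor value and the nodal
  minimum stays above the floor (\<open>floor_le_interpolant\<close>).  The floors never exceed the anchor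
  values: for density and \<open>qcone\<close> this is the minimum in their definition, for the margin it is
  the identity \<open>g_margin (delta_cell \<eta> A) A = (1 - \<eta>) * qcone A\<close>.  Hence the anchor itself is
  certified, and by concavity a later contraction towards it cannot destroy a bound won earlier.
\<close>

section \<open>Concavity of the certified quantities\<close>

lemma linear_dens: "linear dens"
  by (auto intro!: linearI simp: dens_def)

lemma linear_mom: "linear mom"
  by (auto intro!: linearI simp: mom_def)

lemma linear_ener: "linear ener"
  by (auto intro!: linearI simp: ener_def)

lemma Rcone_eq_norm: "Rcone Z = norm (dens Z, mom Z)"
  by (simp add: Rcone_def norm_Pair)

lemma Rcone_nonneg: "0 \<le> Rcone Z"
  by (simp add: Rcone_eq_norm)

lemma convex_on_Rcone: "convex_on UNIV Rcone"
proof (rule convex_onI)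
  fix t :: real and X Y :: state
  assume t: "0 < t" "t < 1"
  have "(dens ((1 - t) *\<^sub>R X + t *\<^sub>R Y), mom ((1 - t) *\<^sub>R X + t *\<^sub>R Y))
      = (1 - t) *\<^sub>R (dens X, mom X) + t *\<^sub>R (dens Y, mom Y)"
    by (simp add: linear_add[OF linear_dens] linear_add[OF linear_mom]
        linear_scale[OF linear_dens] linear_scale[OF linear_mom])
  also have "norm \<dots> \<le> (1 - t) * norm (dens X, mom X) + t * norm (dens Y, mom Y)"
    using t norm_triangle_ineq[of "(1 - t) *\<^sub>R (dens X, mom X)" "t *\<^sub>R (dens Y, mom Y)"]
    by (simp only: norm_scaleR abs_of_pos diff_gt_0_iff_gt)
  finally show "Rcone ((1 - t) *\<^sub>R X + t *\<^sub>R Y) \<le> (1 - t) * Rcone X + t * Rcone Y"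
    by (simp only: Rcone_eq_norm)
qed simp

lemma concave_on_linear:
  fixes f :: "'a::real_vector \<Rightarrow> real"
  assumes "linear f"
  shows "concave_on UNIV f"
  by (simp add: concave_on_iff linear_add[OF assms] linear_scale[OF assms])

lemma concave_on_g_margin:
  assumes "0 \<le> \<delta>"
  shows "concave_on UNIV (g_margin \<delta>)"
proof -
  have "linear (\<lambda>Z. (1 - \<delta>) * ener Z)"
    by (auto intro!: linearI simp: ener_def algebra_simps)
  then have "concave_on UNIV (\<lambda>Z. (1 - \<delta>) * ener Z)"
    by (rule concave_on_linear)
  moreover have "convex_on UNIV (\<lambda>Z. (1 + \<delta>) * Rcone Z)"
    using assms by (intro convex_on_cmul convex_on_Rcone) simp
  ultimately have "concave_on UNIV (\<lambda>Z. (1 - \<delta>) * ener Z - (1 + \<delta>) * Rcone Z)"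
    by (rule concave_on_diff)
  then show ?thesis
    by (simp add: g_margin_def[abs_def])
qed

lemma concave_on_qcone: "concave_on UNIV qcone"
proof -
  have "qcone = g_margin 0"
    by (simp add: fun_eq_iff qcone_def g_margin_def)
  then show ?thesis
    using concave_on_g_margin[of 0] by simp
qed

section \<open>The common scaling factor\<close>

text \<open>
  The factor shared by the three stages, with nodal minimum \<open>m\<close>, anchor value \<open>a\<close> and
  floor \<open>e\<close>.
\<close>

definition scaling_factor :: "real \<Rightarrow> real \<Rightarrow> real \<Rightarrow> real" where
  "scaling_factor m a e = (if m \<ge> e then 1 else (a - e) / (a - m))"

lemma scaling_factor_bounds:
  assumes "e \<le> a"
  shows "0 \<le> scaling_factor m a e" and "scaling_factor m a e \<le> 1"
  using assms by (auto simp: scaling_factor_def field_simps)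

text \<open>
  When the factor is below 1 it solves \<open>(1 - \<theta>) * a + \<theta> * m = e\<close>, so the
  interpolant of the worst node meets the floor and that of any other node stays above it.
\<close>

lemma floor_le_interpolant:
  assumes "e \<le> a" and "m \<le> v" and "\<theta> = scaling_factor m a e"
  shows "e \<le> (1 - \<theta>) * a + \<theta> * v"
proof (cases "e \<le> m")
  case True
  then show ?thesis
    using assms by (simp add: scaling_factor_def)
next
  case False
  then have "\<theta> = (a - e) / (a - m)" and "a - m \<noteq> 0"
    using assms by (auto simp: scaling_factor_def)
  then have "\<theta> * (a - m) = a - e"
    by simp
  then have "e = (1 - \<theta>) * a + \<theta> * m"
    by (simp add: algebra_simps)
  also have "\<dots> \<le> (1 - \<theta>) * a + \<theta> * v"
    using assms scaling_factor_bounds(1)[OF assms(1)] by (simp add: mult_left_mono)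
  finally show ?thesis .
qed

lemma concave_floor_scaled:
  fixes f :: "'a::real_vector \<Rightarrow> real" and U :: "'l \<Rightarrow> 'a"
  assumes f: "concave_on UNIV f" and "e \<le> f A" and "finite L" and "l \<in> L"
    and \<theta>: "\<theta> = scaling_factor (Min ((\<lambda>k. f (U k)) ` L)) (f A) e"
  shows "e \<le> f ((1 - \<theta>) *\<^sub>R A + \<theta> *\<^sub>R U l)"
proof -
  have "Min ((\<lambda>k. f (U k)) ` L) \<le> f (U l)"
    using assms by simp
  then have "e \<le> (1 - \<theta>) * f A + \<theta> * f (U l)"
    by (rule floor_le_interpolant[OF assms(2) _ \<theta>])
  also have "\<dots> \<le> f ((1 - \<theta>) *\<^sub>R A + \<theta> *\<^sub>R U l)"
    using scaling_factor_bounds[OF assms(2)] \<theta> by (intro concave_onD[OF f]) auto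
  finally show ?thesis .
qed

text \<open>Superlevel sets of a concave function are convex: the bounds of earlier stages survive.\<close>

lemma concave_floor_segment:
  fixes f :: "'a::real_vector \<Rightarrow> real"
  assumes f: "concave_on UNIV f" and "e \<le> f A" and "e \<le> f U" and "0 \<le> \<theta>" and "\<theta> \<le> 1"
  shows "e \<le> f ((1 - \<theta>) *\<^sub>R A + \<theta> *\<^sub>R U)"
proof -
  have "e = (1 - \<theta>) * e + \<theta> * e"
    by (simp add: algebra_simps)
  also have "\<dots> \<le> (1 - \<theta>) * f A + \<theta> * f U"
    using assms by (intro add_mono mult_left_mono) auto
  also have "\<dots> \<le> f ((1 - \<theta>) *\<^sub>R A + \<theta> *\<^sub>R U)"
    using assms by (intro concave_onD[OF f]) auto
  finally show ?thesis .
qed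

section \<open>Invariance of the cell average\<close>

lemma cell_avg_add: "cell_avg L \<mu> (\<lambda>l. X l + Y l) = cell_avg L \<mu> X + cell_avg L \<mu> Y"
  by (simp add: cell_avg_def scaleR_add_right sum.distrib)

lemma cell_avg_diff: "cell_avg L \<mu> (\<lambda>l. X l - Y l) = cell_avg L \<mu> X - cell_avg L \<mu> Y"
  by (simp add: cell_avg_def scaleR_diff_right sum_subtractf)

lemma cell_avg_linear:
  assumes "linear T"
  shows "cell_avg L \<mu> (\<lambda>l. T (X l)) = T (cell_avg L \<mu> X)"
  by (simp add: cell_avg_def linear_scale[OF assms] linear_sum[OF assms])

lemma cell_avg_add_linear_deviation:
  assumes "linear T" and "cell_avg L \<mu> V = cell_avg L \<mu> X"
  shows "cell_avg L \<mu> (\<lambda>l. V l + T (V l - X l)) = cell_avg L \<mu> V"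
  using assms
  by (simp add: cell_avg_add cell_avg_linear[OF assms(1), of L \<mu> "\<lambda>l. V l - X l"]
      cell_avg_diff linear_0)

lemma cell_avg_scale_to_reference:
  assumes "cell_avg L \<mu> V = cell_avg L \<mu> X"
  shows "cell_avg L \<mu> (\<lambda>l. X l + \<theta> *\<^sub>R (V l - X l)) = cell_avg L \<mu> V"
proof -
  have "cell_avg L \<mu> (\<lambda>l. V l + (\<theta> - 1) *\<^sub>R (V l - X l)) = cell_avg L \<mu> V"
    by (intro cell_avg_add_linear_deviation assms) (simp add: linear_scale_self)
  moreover have "V l + (\<theta> - 1) *\<^sub>R (V l - X l) = X l + \<theta> *\<^sub>R (V l - X l)" for l
    by (simp add: algebra_simps)
  ultimately show ?thesis
    by simp
qed

lemma cell_avg_W_ref: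
  assumes "cell_avg L \<mu> chi \<noteq> 0"
  shows "cell_avg L \<mu> (W_ref L \<mu> chi W) = cell_avg L \<mu> W"
proof -
  have "cell_avg L \<mu> (W_ref L \<mu> chi W) = cell_avg L \<mu> (\<lambda>l. chi l *\<^sub>R anchor L \<mu> chi W)"
    by (simp add: W_ref_def[abs_def])
  also have "\<dots> = cell_avg L \<mu> chi *\<^sub>R anchor L \<mu> chi W"
    by (rule cell_avg_linear) (rule bounded_linear.linear[OF bounded_linear_scaleR_left])
  finally show ?thesis
    using assms by (simp add: anchor_def)
qed

section \<open>The stages in terms of local states\<close>

lemma W_stage1_eq:
  "W_stage1 L \<mu> chi \<epsilon>D W l =
     W l + (\<lambda>Z. ((theta_D L \<mu> chi \<epsilon>D W - 1) * dens Z, 0, 0)) (W l - W_ref L \<mu> chi W l)"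
  by (simp add: W_stage1_def prod_eq_iff dens_def mom_def ener_def algebra_simps)

lemma cell_avg_W_stage1:
  assumes "cell_avg L \<mu> chi \<noteq> 0"
  shows "cell_avg L \<mu> (W_stage1 L \<mu> chi \<epsilon>D W) = cell_avg L \<mu> W"
proof -
  have "linear (\<lambda>Z. ((theta_D L \<mu> chi \<epsilon>D W - 1) * dens Z, 0 :: real ^ 2, 0 :: real))"
    by (auto intro!: linearI simp: dens_def algebra_simps)
  from cell_avg_add_linear_deviation[OF this cell_avg_W_ref[OF assms, symmetric]]
  show ?thesis
    by (simp add: W_stage1_eq[abs_def])
qed

lemma dens_local_state_W_stage1:
  assumes "chi l \<noteq> 0" and "\<theta> = theta_D L \<mu> chi \<epsilon>D W"
  shows "dens (local_state chi (W_stage1 L \<mu> chi \<epsilon>D W) l)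
    = (1 - \<theta>) * dens (anchor L \<mu> chi W) + \<theta> * dens (local_state chi W l)"
  using assms by (simp add: local_state_def W_stage1_def W_ref_def dens_def field_simps)

lemma local_state_scale_to_reference:
  assumes "chi l \<noteq> 0"
    and "Y l = W_ref L \<mu> chi W l + \<theta> *\<^sub>R (V l - W_ref L \<mu> chi W l)"
  shows "local_state chi Y l = (1 - \<theta>) *\<^sub>R anchor L \<mu> chi W + \<theta> *\<^sub>R local_state chi V l"
proof -
  have "Y l = chi l *\<^sub>R ((1 - \<theta>) *\<^sub>R anchor L \<mu> chi W) + \<theta> *\<^sub>R V l"
    using assms by (simp add: W_ref_def algebra_simps)
  then show ?thesis
    using assms(1) by (simp add: local_state_def scaleR_add_right mult.commute)
qed

lemma theta_D_eq_scaling_factor: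
  "theta_D L \<mu> chi \<epsilon>D W = scaling_factor (Min ((\<lambda>l. dens (local_state chi W l)) ` L))
     (dens (anchor L \<mu> chi W)) (eps_D_eff \<epsilon>D (anchor L \<mu> chi W))"
  by (simp add: theta_D_def scaling_factor_def Let_def)

lemma theta_q_eq_scaling_factor:
  "theta_q L \<mu> chi \<epsilon>D \<epsilon>q W =
     scaling_factor (Min ((\<lambda>l. qcone (local_state chi (W_stage1 L \<mu> chi \<epsilon>D W) l)) ` L))
       (qcone (anchor L \<mu> chi W)) (eps_q_eff \<epsilon>q (anchor L \<mu> chi W))"
  by (simp add: theta_q_def scaling_factor_def Let_def)

lemma theta_delta_eq_scaling_factor:
  assumes "A = anchor L \<mu> chi W" and "\<delta> = delta_cell \<eta> A"
  shows "theta_delta L \<mu> chi \<epsilon>D \<epsilon>q \<eta> W =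
     scaling_factor (Min ((\<lambda>l. g_margin \<delta> (local_state chi (W_stage2 L \<mu> chi \<epsilon>D \<epsilon>q W) l)) ` L))
       (g_margin \<delta> A) 0"
  using assms by (simp add: theta_delta_def scaling_factor_def Let_def)

section \<open>The anchor state\<close>

lemma Gcone_scaleR:
  assumes "c > 0" and "Z \<in> Gcone"
  shows "c *\<^sub>R Z \<in> Gcone"
proof -
  have "Rcone (c *\<^sub>R Z) = norm (c *\<^sub>R (dens Z, mom Z))"
    by (simp add: Rcone_eq_norm dens_def mom_def)
  then have "Rcone (c *\<^sub>R Z) = c * Rcone Z"
    using assms(1) by (simp only: norm_scaleR Rcone_eq_norm abs_of_pos)
  then have "qcone (c *\<^sub>R Z) = c * qcone Z" and "dens (c *\<^sub>R Z) = c * dens Z"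
    by (simp_all add: qcone_def linear_scale[OF linear_ener] linear_scale[OF linear_dens]
        algebra_simps)
  then show ?thesis
    using assms by (simp add: Gcone_def)
qed

lemma delta_cell_nonneg:
  assumes "A \<in> Gcone" and "0 \<le> \<eta>"
  shows "0 \<le> delta_cell \<eta> A"
  using assms Rcone_nonneg[of A] by (simp add: delta_cell_def nu_margin_def Gcone_def qcone_def)

text \<open>
  Since \<open>g_margin \<delta> A = qcone A - \<delta> * (ener A + Rcone A)\<close>, the denominator of \<open>nu_margin\<close>
  cancels and a fraction \<open>\<eta>\<close> of \<open>qcone A\<close> is given away.
\<close>

lemma g_margin_delta_cell:
  assumes "A \<in> Gcone"
  shows "g_margin (delta_cell \<eta> A) A = (1 - \<eta>) * qcone A"
proof -
  have "ener A + Rcone A \<noteq> 0"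
    using assms Rcone_nonneg[of A] by (auto simp: Gcone_def qcone_def)
  then have "nu_margin A * (ener A + Rcone A) = qcone A"
    by (simp add: nu_margin_def qcone_def)
  moreover have "g_margin (delta_cell \<eta> A) A = qcone A - \<eta> * (nu_margin A * (ener A + Rcone A))"
    by (simp add: g_margin_def qcone_def delta_cell_def algebra_simps)
  ultimately show ?thesis
    by (simp add: algebra_simps)
qed

section \<open>The three-stage limiter\<close>

theorem theorem4p4:
  fixes L :: "'l set"
    and \<mu> chi :: "'l \<Rightarrow> real"
    and W :: "'l \<Rightarrow> state"
    and \<epsilon>D \<epsilon>q \<eta> :: real
  assumes "finite L" and "L \<noteq> {}"
    and "\<And>l. l \<in> L \<Longrightarrow> \<mu> l > 0"
    and "\<And>l. l \<in> L \<Longrightarrow> chi l > 0"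
    and "cell_avg L \<mu> chi > 0"
    and "cell_avg L \<mu> W \<in> Gcone"
    and "\<epsilon>D > 0" and "\<epsilon>q > 0" and "0 \<le> \<eta>" and "\<eta> < 1"
  shows "cell_avg L \<mu> (W_stage1 L \<mu> chi \<epsilon>D W) = cell_avg L \<mu> W \<and>
    cell_avg L \<mu> (W_stage2 L \<mu> chi \<epsilon>D \<epsilon>q W) = cell_avg L \<mu> W \<and>
    cell_avg L \<mu> (W_limited L \<mu> chi \<epsilon>D \<epsilon>q \<eta> W) = cell_avg L \<mu> W \<and>
    (\<forall>l\<in>L. local_state chi (W_limited L \<mu> chi \<epsilon>D \<epsilon>q \<eta> W) l \<in> G_cert \<epsilon>D \<epsilon>q \<eta> (anchor L \<mu> chi W)) \<and>
    ((\<forall>l\<in>L. local_state chi W l \<in> G_cert \<epsilon>D \<epsilon>q \<eta> (anchor L \<mu> chi W)) \<longrightarrow>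
         theta_D L \<mu> chi \<epsilon>D W = 1 \<and> theta_q L \<mu> chi \<epsilon>D \<epsilon>q W = 1 \<and>
         theta_delta L \<mu> chi \<epsilon>D \<epsilon>q \<eta> W = 1)"
proof -
  define A where "A = anchor L \<mu> chi W"
  define \<delta> where "\<delta> = delta_cell \<eta> A"
  define eD where "eD = eps_D_eff \<epsilon>D A"
  define eq where "eq = eps_q_eff \<epsilon>q A"
  define W1 where "W1 = W_stage1 L \<mu> chi \<epsilon>D W"
  define W2 where "W2 = W_stage2 L \<mu> chi \<epsilon>D \<epsilon>q W"
  define W3 where "W3 = W_limited L \<mu> chi \<epsilon>D \<epsilon>q \<eta> W"
  define \<theta>1 where "\<theta>1 = theta_D L \<mu> chi \<epsilon>D W"
  define \<theta>2 where "\<theta>2 = theta_q L \<mu> chi \<epsilon>D \<epsilon>q W"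
  define \<theta>3 where "\<theta>3 = theta_delta L \<mu> chi \<epsilon>D \<epsilon>q \<eta> W"

  have W2: "W2 l = W_ref L \<mu> chi W l + \<theta>2 *\<^sub>R (W1 l - W_ref L \<mu> chi W l)" for l
    by (simp add: W2_def W_stage2_def \<theta>2_def W1_def)
  have W3: "W3 l = W_ref L \<mu> chi W l + \<theta>3 *\<^sub>R (W2 l - W_ref L \<mu> chi W l)" for l
    by (simp add: W3_def W_limited_def \<theta>3_def W2_def)

  have ref: "cell_avg L \<mu> (W_ref L \<mu> chi W) = cell_avg L \<mu> W"
    using assms(5) by (intro cell_avg_W_ref) simp
  have avg1: "cell_avg L \<mu> W1 = cell_avg L \<mu> W"
    unfolding W1_def using assms(5) by (intro cell_avg_W_stage1) simp
  have avg2: "cell_avg L \<mu> W2 = cell_avg L \<mu> W"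
    using cell_avg_scale_to_reference[of L \<mu> W1 "W_ref L \<mu> chi W" \<theta>2] ref avg1
    by (simp add: W2[abs_def])
  have avg3: "cell_avg L \<mu> W3 = cell_avg L \<mu> W"
    using cell_avg_scale_to_reference[of L \<mu> W2 "W_ref L \<mu> chi W" \<theta>3] ref avg2
    by (simp add: W3[abs_def])

  have A: "A \<in> Gcone"
    unfolding A_def anchor_def using assms(5,6) by (intro Gcone_scaleR) simp_all
  have eD: "eD \<le> dens A" and eq: "eq \<le> qcone A"
    by (simp_all add: eD_def eq_def eps_D_eff_def eps_q_eff_def)
  have gA: "0 \<le> g_margin \<delta> A"
    using A assms(10) by (simp add: \<delta>_def g_margin_delta_cell Gcone_def)
  have conc_g: "concave_on UNIV (g_margin \<delta>)"
    unfolding \<delta>_def by (intro concave_on_g_margin delta_cell_nonneg A assms)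

  have \<theta>1: "\<theta>1 = scaling_factor (Min ((\<lambda>l. dens (local_state chi W l)) ` L)) (dens A) eD"
    by (simp add: \<theta>1_def theta_D_eq_scaling_factor A_def eD_def)
  have \<theta>2: "\<theta>2 = scaling_factor (Min ((\<lambda>l. qcone (local_state chi W1 l)) ` L)) (qcone A) eq"
    by (simp add: \<theta>2_def theta_q_eq_scaling_factor A_def eq_def W1_def)
  have \<theta>3: "\<theta>3 = scaling_factor (Min ((\<lambda>l. g_margin \<delta> (local_state chi W2 l)) ` L))
      (g_margin \<delta> A) 0"
    by (simp add: \<theta>3_def theta_delta_eq_scaling_factor[OF A_def \<delta>_def] W2_def)

  have cert: "local_state chi W3 l \<in> G_cert \<epsilon>D \<epsilon>q \<eta> A" if l: "l \<in> L" for l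
  proof -
    have chi: "chi l \<noteq> 0"
      using assms(4)[OF l] by simp
    have U2: "local_state chi W2 l = (1 - \<theta>2) *\<^sub>R A + \<theta>2 *\<^sub>R local_state chi W1 l"
      unfolding A_def by (intro local_state_scale_to_reference chi W2)
    have U3: "local_state chi W3 l = (1 - \<theta>3) *\<^sub>R A + \<theta>3 *\<^sub>R local_state chi W2 l"
      unfolding A_def by (intro local_state_scale_to_reference chi W3)
    have t2: "0 \<le> \<theta>2" "\<theta>2 \<le> 1"
      unfolding \<theta>2 by (intro scaling_factor_bounds[OF eq])+
    have t3: "0 \<le> \<theta>3" "\<theta>3 \<le> 1"
      unfolding \<theta>3 by (intro scaling_factor_bounds[OF gA])+
    note conc_dens = concave_on_linear[OF linear_dens]

    have "eD \<le> (1 - \<theta>1) * dens A + \<theta>1 * dens (local_state chi W l)"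
      using assms(1) l by (intro floor_le_interpolant[OF eD _ \<theta>1]) simp
    then have D1: "eD \<le> dens (local_state chi W1 l)"
      unfolding W1_def A_def by (simp only: dens_local_state_W_stage1[OF chi \<theta>1_def])
    have D2: "eD \<le> dens (local_state chi W2 l)"
      unfolding U2 by (rule concave_floor_segment[OF conc_dens eD D1 t2])
    have D3: "eD \<le> dens (local_state chi W3 l)"
      unfolding U3 by (rule concave_floor_segment[OF conc_dens eD D2 t3])
    have q2: "eq \<le> qcone (local_state chi W2 l)"
      unfolding U2 by (rule concave_floor_scaled[OF concave_on_qcone eq assms(1) l \<theta>2])
    have q3: "eq \<le> qcone (local_state chi W3 l)"
      unfolding U3 by (rule concave_floor_segment[OF concave_on_qcone eq q2 t3])
    have g3: "0 \<le> g_margin \<delta> (local_state chi W3 l)"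
      unfolding U3 by (rule concave_floor_scaled[OF conc_g gA assms(1) l \<theta>3])
    from D3 q3 g3 show ?thesis
      by (simp add: G_cert_def eD_def eq_def \<delta>_def)
  qed

  have inactive: "\<theta>1 = 1 \<and> \<theta>2 = 1 \<and> \<theta>3 = 1"
    if "\<forall>l\<in>L. local_state chi W l \<in> G_cert \<epsilon>D \<epsilon>q \<eta> A"
  proof -
    have bounds: "eD \<le> dens (local_state chi W l)" "eq \<le> qcone (local_state chi W l)"
      "0 \<le> g_margin \<delta> (local_state chi W l)" if "l \<in> L" for l
      using \<open>\<forall>l\<in>L. local_state chi W l \<in> G_cert \<epsilon>D \<epsilon>q \<eta> A\<close> that
      by (auto simp: G_cert_def eD_def eq_def \<delta>_def)
    \<comment> \<open>A factor equal to 1 leaves the field unchanged, so the next stage sees \<open>W\<close> itself.\<close>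
    have "\<theta>1 = 1"
      using assms(1,2) bounds(1) by (simp add: \<theta>1 scaling_factor_def)
    then have "W1 = W"
      by (simp add: fun_eq_iff W1_def W_stage1_eq \<theta>1_def prod_eq_iff)
    then have "\<theta>2 = 1"
      using assms(1,2) bounds(2) by (simp add: \<theta>2 scaling_factor_def)
    then have "W2 = W"
      using \<open>W1 = W\<close> by (simp add: fun_eq_iff W2)
    then have "\<theta>3 = 1"
      using assms(1,2) bounds(3) by (simp add: \<theta>3 scaling_factor_def)
    with \<open>\<theta>1 = 1\<close> \<open>\<theta>2 = 1\<close> show ?thesis
      by simp
  qed

  from avg1 avg2 avg3 cert inactive show ?thesis
    unfolding A_def W1_def W2_def W3_def \<theta>1_def \<theta>2_def \<theta>3_def by blast
qed

end
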